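(* Let $d \geq 0$, let $a_0,\dots,a_d$ be pairwise relatively prime positive integers, and let $n$ be an integer with $0 < n < a_0 + \dots + a_d$. Then \[ \sum_{j=0}^{d} \sigma_n\left(a_0,\dots,\widehat{a_j},\dots,a_d; a_j\right) = -\, q(a_0,\dots,a_d,-n), \] where $\widehat{a_j}$ means $a_j$ is omitted.
   Context: Fourier–Dedekind sum: for integers $b_1,\dots,b_m$, a positive integer $b_0$ and an integer $n$, \[ \sigma_n(b_1,\dots,b_m; b_0) := \frac{1}{b_0} \sum_{\lambda^{b_0}=1} \frac{\lambda^{n}}{(1-\lambda^{b_1})\cdots(1-\lambda^{b_m})}, \] where the sum runs over those complex $b_0$-th roots of unity $\lambda$ for which the summand is not singular (an empty sum is $0$). The function $q$: for an integer $n$, let $f_n(z) := \dfrac{z^{-n}}{(1-z^{a_0})(1-z^{a_1})\cdots(1-z^{a_d})}$, and write the principal part of its Laurent expansion about $z=1$ as $\sum_{k=1}^{d+1} \frac{B_k}{(z-1)^k}$. Define $q(a_0,\dots,a_d,n) := \sum_{k=1}^{d+1} (-1)^k B_k$; thus $q(a_0,\dots,a_d,-n)$ is this quantity for the function $z^{n}/\prod_{j}(1-z^{a_j})$.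
   Formalization: For d = 0 the sum defining σ_n( ; a_0), which has no parameters b_i, is taken to omit λ = 1; with λ = 1 included the identity fails (a_0 = 2, n = 1: left side 0, right side −1/2). *)

theory Defs
  imports "HOL-Complex_Analysis.Complex_Analysis"
begin

text \<open>
  The parameters $b_1, \dots, b_m$ of a Fourier--Dedekind sum are given as a family \<open>b\<close> over a
  finite index set \<open>I\<close>, so that omitting a parameter means removing an index.

  A root of unity \<open>\<omega>\<close> is nonzero, so the summand is singular at \<open>\<omega>\<close> iff some factor
  \<open>1 - \<omega> powi b i\<close> vanishes. If \<open>I\<close> is nonempty, this always excludes \<open>\<omega> = 1\<close>.
  For \<open>I = {}\<close> no factor is left that could exclude \<open>\<omega> = 1\<close>, and the convention made here is
  that it is excluded nevertheless: the sums run over poles other than \<open>1\<close> of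
  $z^n / \prod_j (1 - z^{a_j})$, also when this product has a single factor. With \<open>\<omega> = 1\<close>
  included, the reciprocity law would fail for a single parameter: for $a_0 = 2$ and $n = 1$ its left side
  would be $0$, and its right side is $-1/2$.
\<close>

definition fd_roots :: "('i \<Rightarrow> int) \<Rightarrow> 'i set \<Rightarrow> nat \<Rightarrow> complex set" where
  "fd_roots b I b0 =
     {\<omega>. \<omega> ^ b0 = 1 \<and> (\<forall>i\<in>I. \<omega> powi b i \<noteq> 1) \<and> (I = {} \<longrightarrow> \<omega> \<noteq> 1)}"

definition fourier_dedekind :: "int \<Rightarrow> ('i \<Rightarrow> int) \<Rightarrow> 'i set \<Rightarrow> nat \<Rightarrow> complex" where
  "fourier_dedekind n b I b0 =
     1 / of_nat b0 * (\<Sum>\<omega>\<in>fd_roots b I b0. \<omega> powi n / (\<Prod>i\<in>I. 1 - \<omega> powi b i))"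

text \<open>The number $B_k$ is the coefficient of $(z-1)^{-k}$ in the Laurent expansion at $1$.\<close>

definition q_fun :: "(nat \<Rightarrow> nat) \<Rightarrow> nat \<Rightarrow> int \<Rightarrow> complex" where
  "q_fun a d n =
     (let f = (\<lambda>z::complex. z powi (- n) / (\<Prod>j\<le>d. 1 - z ^ a j));
          B = (\<lambda>k::nat. fls_nth (laurent_expansion f 1) (- int k))
      in \<Sum>k=1..d+1. (- 1) ^ k * B k)"

end

theory Submission
  imports Defs
begin

text \<open>
  Let $F(z) = z^{n-1} / \prod_j (1 - z^{a_j})$. Since $n \ge 1$, its poles are all roots of unity, and
  since $n < \sum_j a_j$ we have $z F(z) \to 0$ at infinity, so the residues of $F$ add up to $0$.
  By coprimality, a pole $\lambda \ne 1$ is a root of exactly one factor $1 - z^{a_j}$; the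
  residue there is minus the summand of the Fourier--Dedekind sum for $a_j$. At $1$, multiplying
  the principal part of $z F(z)$ by $1/z = \sum_k (-1)^k (z-1)^k$ shows that the residue is minus
  the alternating sum of the $B_k$.
\<close>

text \<open>On a circle of large radius \<open>R\<close> around 0 the integrand is at most
  \<open>e / R\<close>, so the integral is at most \<open>2 * pi * e\<close>; the residue theorem
  then bounds the sum by \<open>e\<close>, for every \<open>e > 0\<close>.\<close>

lemma sum_residues_eq_0:
  fixes f :: "complex \<Rightarrow> complex"
  assumes fin: "finite pts" and holo: "f holomorphic_on UNIV - pts"
    and lim: "((\<lambda>z. z * f z) \<longlongrightarrow> 0) at_infinity"
  shows "(\<Sum>p\<in>pts. residue f p) = 0"
proof -
  have bound: "norm (\<Sum>p\<in>pts. residue f p) \<le> e" if "e > 0" for e :: real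
  proof -
    have "eventually (\<lambda>z. norm (z * f z) < e) at_infinity"
      using tendstoD[OF lim \<open>e > 0\<close>] by (simp add: dist_norm)
    then obtain b where b: "\<And>z. b \<le> norm z \<Longrightarrow> norm (z * f z) < e"
      by (auto simp: eventually_at_infinity)
    have "bounded pts"
      using fin by (rule finite_imp_bounded)
    then obtain c where c: "\<And>z. z \<in> pts \<Longrightarrow> norm z \<le> c"
      by (auto simp: bounded_iff)
    \<comment> \<open>\<open>b\<close> makes the estimate valid on the circle, \<open>c + 1\<close>
      puts all of \<open>pts\<close> strictly inside it, and \<open>1\<close> keeps the radius
      positive.\<close>
    define R where "R = max 1 (max b (c + 1))"
    have R: "R > 0" "R \<ge> b" "R > c"
      unfolding R_def by auto
    have inside: "norm p < R" if "p \<in> pts" for p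
      using c[OF that] R by simp
    have img: "path_image (circlepath 0 R) \<subseteq> UNIV - pts"
      using inside R by fastforce
    have int_eq: "contour_integral (circlepath 0 R) f
        = 2 * pi * \<i> * (\<Sum>p\<in>pts. winding_number (circlepath 0 R) p * residue f p)"
      by (rule Residue_theorem[OF _ _ fin holo]) (use img in auto)
    also have "(\<Sum>p\<in>pts. winding_number (circlepath 0 R) p * residue f p)
        = (\<Sum>p\<in>pts. residue f p)"
      by (intro sum.cong refl) (simp add: winding_number_circlepath inside)
    finally have int_eq': "contour_integral (circlepath 0 R) f
        = 2 * pi * \<i> * (\<Sum>p\<in>pts. residue f p)" .
    have "f contour_integrable_on circlepath 0 R"
      by (rule contour_integrable_holomorphic_simple[OF holo _ _ img])
         (use fin in \<open>auto simp: open_Diff finite_imp_closed\<close>)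
    then have "norm (contour_integral (circlepath 0 R) f) \<le> e / R * (2 * pi * R)"
    proof (rule has_contour_integral_bound_circlepath[OF has_contour_integral_integral])
      show "norm (f x) \<le> e / R" if "norm (x - 0) = R" for x
        using b[of x] that R by (simp add: norm_mult field_simps)
    qed (use R \<open>e > 0\<close> in auto)
    then show ?thesis
      unfolding int_eq' using R by (simp add: norm_mult)
  qed
  then have "norm (\<Sum>p\<in>pts. residue f p) \<le> 0"
    by (rule field_le_epsilon[of _ 0, simplified])
  then show ?thesis
    by simp
qed

text \<open>Taking \<open>z ^ a j\<close> out of each factor leaves a positive power of
  \<open>inverse z\<close> over a product whose factors all tend to \<open>-1\<close>.\<close>

lemma tendsto_power_div_prod_at_infinity:
  fixes a :: "'i \<Rightarrow> nat"
  assumes "finite I" and pos: "\<And>j. j \<in> I \<Longrightarrow> a j > 0" and less: "m < (\<Sum>j\<in>I. a j)"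
  shows "((\<lambda>z::complex. z ^ m / (\<Prod>j\<in>I. 1 - z ^ a j)) \<longlongrightarrow> 0) at_infinity"
proof -
  define S where "S = (\<Sum>j\<in>I. a j)"
  have inv: "((\<lambda>z::complex. inverse z ^ k) \<longlongrightarrow> 0) at_infinity" if "k > 0" for k
    using tendsto_power[OF tendsto_inverse_0, of k] that by (simp add: power_0_left)
  have "((\<lambda>z::complex. inverse z ^ (S - m) / (\<Prod>j\<in>I. inverse z ^ a j - 1))
      \<longlongrightarrow> 0 / (\<Prod>j\<in>I. 0 - 1)) at_infinity"
    using less by (intro tendsto_intros inv) (auto simp: S_def pos)
  then have "((\<lambda>z::complex. inverse z ^ (S - m) / (\<Prod>j\<in>I. inverse z ^ a j - 1))
      \<longlongrightarrow> 0) at_infinity"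
    by simp
  moreover have "eventually (\<lambda>z::complex. z ^ m / (\<Prod>j\<in>I. 1 - z ^ a j)
      = inverse z ^ (S - m) / (\<Prod>j\<in>I. inverse z ^ a j - 1)) at_infinity"
  proof -
    have "z ^ m / (\<Prod>j\<in>I. 1 - z ^ a j) = inverse z ^ (S - m) / (\<Prod>j\<in>I. inverse z ^ a j - 1)"
      if "1 \<le> norm z" for z :: complex
    proof -
      have z: "z \<noteq> 0" using that by auto
      have "(\<Prod>j\<in>I. 1 - z ^ a j) = (\<Prod>j\<in>I. z ^ a j * (inverse z ^ a j - 1))"
        using z by (intro prod.cong refl) (simp add: field_simps)
      also have "\<dots> = z ^ S * (\<Prod>j\<in>I. inverse z ^ a j - 1)"
        by (simp add: prod.distrib S_def power_sum)
      finally have *: "(\<Prod>j\<in>I. 1 - z ^ a j) = z ^ S * (\<Prod>j\<in>I. inverse z ^ a j - 1)" .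
      have "z ^ S = z ^ m * z ^ (S - m)"
        using less by (simp add: S_def flip: power_add)
      then show ?thesis
        unfolding * using z by (simp add: field_simps)
    qed
    then show ?thesis
      unfolding eventually_at_infinity by blast
  qed
  ultimately show ?thesis
    by (simp add: filterlim_cong)
qed

text \<open>The zero of \<open>1 - w ^ a\<close> at \<open>z\<close> is simple, with derivative
  \<open>- of_nat a * z ^ (a - 1)\<close>, which is \<open>- of_nat a / z\<close> because
  \<open>z ^ a = 1\<close>.\<close>

lemma residue_div_root_of_unity:
  fixes g :: "complex \<Rightarrow> complex"
  assumes "a > 0" "z ^ a = 1" and s: "open s" "z \<in> s" and g: "isCont g z"
    and holo: "(\<lambda>w. g w / (1 - w ^ a)) holomorphic_on (s - {z})"
  shows "residue (\<lambda>w. g w / (1 - w ^ a)) z = - (z * g z / of_nat a)"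
proof (rule residue_simple'[OF s holo])
  have z: "z \<noteq> 0"
    using assms by (auto simp: power_0_left)
  have "((\<lambda>w. 1 - w ^ a) has_field_derivative - (of_nat a * z ^ (a - 1))) (at z)"
    by (auto intro!: derivative_eq_intros)
  \<comment> \<open>As \<open>1 - w ^ a\<close> vanishes at \<open>w = z\<close>, this is its
    difference quotient.\<close>
  then have "((\<lambda>w. (1 - w ^ a) / (w - z)) \<longlongrightarrow> - (of_nat a * z ^ (a - 1))) (at z)"
    using assms by (simp add: has_field_derivative_iff)
  then have "((\<lambda>w. g w / ((1 - w ^ a) / (w - z))) \<longlongrightarrow> g z / - (of_nat a * z ^ (a - 1))) (at z)"
    using g z \<open>a > 0\<close> by (intro tendsto_divide) (auto simp: isCont_def)
  moreover have "g z / - (of_nat a * z ^ (a - 1)) = - (z * g z / of_nat a)"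
  proof -
    have "z ^ (a - 1) = inverse z"
      using assms z by (metis inverse_unique power_eq_if neq0_conv)
    then show ?thesis
      by (simp add: field_simps)
  qed
  ultimately show "((\<lambda>w. g w / (1 - w ^ a) * (w - z)) \<longlongrightarrow> - (z * g z / of_nat a)) (at z)"
    by simp
qed

text \<open>With \<open>z = 1 + w\<close>, the coefficient of \<open>F\<close> at \<open>- k\<close>
  meets the coefficient of \<open>1 / (1 + w)\<close> at \<open>k - 1\<close>, which is
  \<open>(- 1) ^ (k - 1)\<close>; this shift by one is the source of the minus sign.\<close>

lemma residue_div_self_at_1:
  assumes F: "(\<lambda>w. f (1 + w)) has_laurent_expansion F" and sub: "- int N \<le> fls_subdegree F"
  shows "residue (\<lambda>z. f z / z) 1 = - (\<Sum>k=1..N. (- 1) ^ k * fls_nth F (- int k))"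
proof -
  define G :: "complex fls" where "G = fps_to_fls (inverse (1 + fps_X))"
  have "(\<lambda>w::complex. inverse (1 + w)) has_fps_expansion inverse (1 + fps_X)"
    by (intro fps_expansion_intros) auto
  then have "(\<lambda>w::complex. inverse (1 + w)) has_laurent_expansion G"
    unfolding G_def by (rule has_laurent_expansion_fps)
  then have "(\<lambda>w. f (1 + w) * inverse (1 + w)) has_laurent_expansion F * G"
    by (intro has_laurent_expansion_mult F)
  then have "residue (\<lambda>z. f z / z) 1 = fls_nth (F * G) (- 1)"
    by (subst has_laurent_expansion_residue[of _ _ "F * G"]) (auto simp: divide_inverse)
  also have "\<dots> = (\<Sum>i=fls_subdegree F..- 1. fls_nth F i * fls_nth G (- 1 - i))"
  proof -
    have "fls_subdegree G = 0"
      unfolding G_def by (simp add: fls_subdegree_fls_to_fps subdegree_eq_0_iff)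
    then show ?thesis
      by (simp add: fls_times_nth(2))
  qed
  \<comment> \<open>The added coefficients of \<open>F\<close> lie below its subdegree and are
    0.\<close>
  also have "\<dots> = (\<Sum>i=- int N..- 1. fls_nth F i * fls_nth G (- 1 - i))"
    using sub by (intro sum.mono_neutral_left) auto
  also have "\<dots> = (\<Sum>k=1..N. fls_nth F (- int k) * fls_nth G (int k - 1))"
    by (rule sum.reindex_bij_witness[of _ "\<lambda>k. - int k" "\<lambda>i. nat (- i)"])
       (auto simp: minus_diff_commute)
  also have "\<dots> = (\<Sum>k=1..N. - ((- 1) ^ k * fls_nth F (- int k)))"
  proof (intro sum.cong refl)
    fix k assume "k \<in> {1..N}"
    then obtain l where "k = Suc l"
      by (cases k) auto
    then show "fls_nth F (- int k) * fls_nth G (int k - 1) = - ((- 1) ^ k * fls_nth F (- int k))"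
      by (simp add: G_def fps_inverse_fps_X_plus1)
  qed
  finally show ?thesis
    by (simp add: sum_negf)
qed

lemma subdegree_1_minus_power:
  assumes "a > 0"
  shows "subdegree (1 - (1 + fps_X) ^ a :: 'a :: field_char_0 fps) = 1"
proof (rule subdegreeI)
  \<comment> \<open>The linear coefficient is the constant term of the derivative
    \<open>of_nat a * (1 + fps_X) ^ (a - 1)\<close>.\<close>
  have "fps_nth ((1 + fps_X :: 'a fps) ^ a) 1 = fps_nth (fps_deriv ((1 + fps_X) ^ a)) 0"
    by simp
  also have "\<dots> = of_nat a"
    by (subst fps_deriv_power) (simp add: fps_power_zeroth)
  finally show "fps_nth (1 - (1 + fps_X) ^ a :: 'a fps) 1 \<noteq> 0"
    using assms by simp
qed (simp add: fps_power_zeroth)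

text \<open>Each factor of the denominator has a simple zero at \<open>w = 0\<close> and the
  numerator is 1 there, so the pole has order \<open>card I\<close>. For \<open>I = {..d}\<close>
  this is \<open>d + 1\<close>, the upper limit of the sum in \<open>q_fun\<close>.\<close>

lemma laurent_expansion_at_1:
  fixes a :: "'i \<Rightarrow> nat"
  assumes "finite I" and pos: "\<And>j. j \<in> I \<Longrightarrow> a j > 0"
  obtains F where "(\<lambda>w::complex. (1 + w) ^ n / (\<Prod>j\<in>I. 1 - (1 + w) ^ a j)) has_laurent_expansion F"
    and "fls_subdegree F = - int (card I)"
proof -
  define P where "P = (\<lambda>j. 1 - (1 + fps_X :: complex fps) ^ a j)"
  define F where "F = fps_to_fls ((1 + fps_X :: complex fps) ^ n) / (\<Prod>j\<in>I. fps_to_fls (P j))"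
  have sub: "subdegree (P j) = 1" if "j \<in> I" for j
    unfolding P_def by (rule subdegree_1_minus_power[OF pos[OF that]])
  then have nz: "P j \<noteq> 0" if "j \<in> I" for j
    using that by fastforce
  have "(\<lambda>w::complex. (1 + w) ^ n / (\<Prod>j\<in>I. 1 - (1 + w) ^ a j)) has_laurent_expansion F"
    unfolding F_def P_def
    by (intro has_laurent_expansion_divide has_laurent_expansion_prod has_laurent_expansion_fps
          fps_expansion_intros)
  moreover have "fls_subdegree F = - int (card I)"
  proof -
    have *: "(1 + fps_X :: complex fps) ^ n \<noteq> 0" "subdegree ((1 + fps_X :: complex fps) ^ n) = 0"
      by (auto simp: subdegree_eq_0_iff fps_power_zeroth dest: arg_cong[of _ _ "\<lambda>f. fps_nth f 0"])
    have "(\<Prod>j\<in>I. fps_to_fls (P j)) \<noteq> 0"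
      using nz \<open>finite I\<close> by simp
    moreover have "fls_subdegree (\<Prod>j\<in>I. fps_to_fls (P j)) = int (card I)"
      using nz sub by (subst fls_subdegree_prod) (auto simp: fls_subdegree_fls_to_fps)
    ultimately show ?thesis
      unfolding F_def divide_inverse using *
      by (subst fls_subdegree_mult) (auto simp: fls_subdegree_fls_to_fps)
  qed
  ultimately show ?thesis
    by (rule that)
qed

text \<open>By Bezout, \<open>z = z ^ gcd m n\<close> is a quotient of powers of
  \<open>z ^ m\<close> and \<open>z ^ n\<close>. The subtraction-free identity over the naturals
  requires \<open>m \<noteq> 0\<close>; for \<open>m = 0\<close>, coprimality forces
  \<open>n = 1\<close>.\<close>

lemma coprime_roots_of_unity:
  fixes z :: complex
  assumes "coprime m n" "z ^ m = 1" "z ^ n = 1"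
  shows "z = 1"
proof (cases "m = 0")
  case True
  then show ?thesis
    using assms by simp
next
  case False
  obtain x y where "m * x = n * y + gcd m n"
    using bezout_nat[OF False] by blast
  then have "z ^ (m * x) = z ^ (n * y) * z"
    using assms by simp
  then show ?thesis
    using assms by (simp add: power_mult)
qed

theorem theorem4p4:
  fixes a :: "nat \<Rightarrow> nat" and d :: nat and n :: int
  assumes "\<forall>j\<le>d. a j > 0"
    and "\<forall>i\<le>d. \<forall>j\<le>d. i \<noteq> j \<longrightarrow> coprime (a i) (a j)"
    and "0 < n" and "n < (\<Sum>j\<le>d. int (a j))"
  shows "(\<Sum>j\<le>d. fourier_dedekind n (\<lambda>i. int (a i)) ({..d} - {j}) (a j)) = - q_fun a d (- n)"
proof -
  have pos: "\<And>j. j \<in> {..d} \<Longrightarrow> a j > 0"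
    using assms(1) by simp
  obtain m where n: "n = int (Suc m)"
    using zero_less_imp_eq_int[OF \<open>0 < n\<close>] gr0_implies_Suc by blast
  have "int (Suc m) < int (\<Sum>j\<le>d. a j)"
    using assms(4) unfolding n of_nat_sum .
  then have less: "Suc m < (\<Sum>j\<le>d. a j)"
    by (simp only: of_nat_less_iff)
  \<comment> \<open>\<open>f\<close> is the function whose principal part at 1 defines
    \<open>q_fun a d (- n)\<close>; away from 0, \<open>F\<close> is \<open>f z / z\<close>.\<close>
  define f where "f = (\<lambda>z::complex. z ^ Suc m / (\<Prod>j\<le>d. 1 - z ^ a j))"
  define F where "F = (\<lambda>z::complex. z ^ m / (\<Prod>j\<le>d. 1 - z ^ a j))"
  define A where "A = (\<lambda>j. {\<omega>::complex. \<omega> ^ a j = 1 \<and> \<omega> \<noteq> 1})"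
  define pts where "pts = insert 1 (\<Union>j\<le>d. A j)"
  have finA: "finite (A j)" if "j \<le> d" for j
    unfolding A_def
    by (rule finite_subset[OF _ finite_roots_unity[of "a j"]]) (use pos[of j] that in auto)
  then have fin: "finite pts"
    unfolding pts_def by auto
  \<comment> \<open>A common root of two factors would be 1 by coprimality. This gives both the
    disjointness of the sets \<open>A j\<close> and the simplicity of the poles in them.\<close>
  have other: "\<omega> ^ a i \<noteq> 1" if "\<omega> \<in> A j" "i \<le> d" "j \<le> d" "i \<noteq> j" for \<omega> i j
    using that coprime_roots_of_unity[of "a i" "a j" \<omega>] assms(2) by (auto simp: A_def)
  have holo: "F holomorphic_on UNIV - pts"
    unfolding F_def by (intro holomorphic_intros) (auto simp: pts_def A_def)

  have "((\<lambda>z. z * F z) \<longlongrightarrow> 0) at_infinity"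
    using tendsto_power_div_prod_at_infinity[OF finite_atMost pos less] by (simp add: F_def)
  then have "(\<Sum>p\<in>pts. residue F p) = 0"
    by (rule sum_residues_eq_0[OF fin holo])
  moreover have "(\<Sum>p\<in>pts. residue F p) = residue F 1 + (\<Sum>j\<le>d. \<Sum>p\<in>A j. residue F p)"
  proof -
    have "(\<Sum>p\<in>(\<Union>j\<le>d. A j). residue F p) = (\<Sum>j\<le>d. \<Sum>p\<in>A j. residue F p)"
    proof (rule sum.UNION_disjoint)
      show "\<forall>i\<in>{..d}. \<forall>j\<in>{..d}. i \<noteq> j \<longrightarrow> A i \<inter> A j = {}"
        using other by (fastforce simp: A_def)
    qed (simp_all add: finA)
    moreover have "1 \<notin> (\<Union>j\<le>d. A j)"
      by (auto simp: A_def)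
    ultimately show ?thesis
      unfolding pts_def using finA by (subst sum.insert) auto
  qed
  moreover have "(\<Sum>p\<in>A j. residue F p)
      = - fourier_dedekind n (\<lambda>i. int (a i)) ({..d} - {j}) (a j)" if j: "j \<le> d" for j
  proof -
    have "fd_roots (\<lambda>i. int (a i)) ({..d} - {j}) (a j) = A j"
    proof (intro equalityI subsetI)
      fix \<omega> assume "\<omega> \<in> fd_roots (\<lambda>i. int (a i)) ({..d} - {j}) (a j)"
      then show "\<omega> \<in> A j"
        \<comment> \<open>For \<open>d = 0\<close> no index is left, and 1 is excluded by the
          convention in \<open>fd_roots\<close>; otherwise any remaining index excludes it.\<close>
        by (cases "{..d} - {j} = {}") (auto simp: fd_roots_def A_def)
    next
      fix \<omega> assume \<omega>: "\<omega> \<in> A j"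
      then have "\<forall>i\<in>{..d} - {j}. \<omega> ^ a i \<noteq> 1"
        using other[OF _ _ j] by blast
      with \<omega> show "\<omega> \<in> fd_roots (\<lambda>i. int (a i)) ({..d} - {j}) (a j)"
        by (simp add: fd_roots_def A_def)
    qed
    moreover have "residue F p = - (p ^ Suc m / (\<Prod>i\<in>{..d} - {j}. 1 - p ^ a i) / of_nat (a j))"
      if p: "p \<in> A j" for p
    proof -
      \<comment> \<open>\<open>g\<close> collects the factors that do not vanish at
        \<open>p\<close>; the factor \<open>p\<close> in the residue formula turns its numerator
        \<open>p ^ m\<close> into \<open>p ^ Suc m\<close>.\<close>
      define g where "g = (\<lambda>w::complex. w ^ m / (\<Prod>i\<in>{..d} - {j}. 1 - w ^ a i))"
      have F_eq: "F = (\<lambda>w. g w / (1 - w ^ a j))"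
        unfolding F_def g_def using j by (subst prod.remove[of _ j]) (auto simp: mult_ac)
      \<comment> \<open>An open neighbourhood of \<open>p\<close> that contains no other pole of
        \<open>F\<close>.\<close>
      define s where "s = UNIV - (pts - {p})"
      have "open s"
        unfolding s_def using fin by (simp add: open_Diff finite_imp_closed)
      moreover have "F holomorphic_on s - {p}"
        using holo by (rule holomorphic_on_subset) (auto simp: s_def)
      moreover have "isCont g p"
        unfolding g_def using other[OF p _ j] by (intro continuous_intros) auto
      ultimately have "residue F p = - (p * g p / of_nat (a j))"
        using p pos[of j] j unfolding F_eq
        by (intro residue_div_root_of_unity[where s = s]) (auto simp: A_def s_def)
      then show ?thesis
        by (simp add: g_def)
    qed
    ultimately show ?thesis
      by (simp add: fourier_dedekind_def n sum_negf sum_divide_distrib del: power_Suc of_nat_Suc)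
  qed
  moreover have "residue F 1 = - q_fun a d (- n)"
  proof -
    obtain L where L: "(\<lambda>w. f (1 + w)) has_laurent_expansion L"
      and sub: "fls_subdegree L = - int (card {..d})"
      unfolding f_def by (rule laurent_expansion_at_1[OF finite_atMost pos])
    have "residue F 1 = residue (\<lambda>z. f z / z) 1"
    proof (rule residue_cong)
      \<comment> \<open>\<open>F z\<close> and \<open>f z / z\<close> can differ only at 0, which
        does not affect the residue at 1.\<close>
      have "eventually (\<lambda>z::complex. z \<in> - {0}) (at 1)"
        by (intro eventually_at_in_open') auto
      then show "eventually (\<lambda>z. F z = f z / z) (at 1)"
        by eventually_elim (auto simp: F_def f_def)
    qed simp
    also have "\<dots> = - (\<Sum>k=1..d+1. (- 1) ^ k * fls_nth L (- int k))"
      by (rule residue_div_self_at_1[OF L]) (simp add: sub)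
    also have "\<dots> = - q_fun a d (- n)"
      \<comment> \<open>Uniqueness of the Laurent expansion identifies \<open>L\<close> with the
        series in \<open>q_fun\<close>.\<close>
      unfolding q_fun_def n laurent_expansion_eqI[OF L, symmetric] f_def Let_def
      by (simp del: power_Suc of_nat_Suc)
    finally show ?thesis .
  qed
  \<comment> \<open>The vanishing total is \<open>residue F 1\<close> minus the sum of the
    Fourier-Dedekind sums, so the latter equals \<open>residue F 1\<close>.\<close>
  ultimately show ?thesis
    by (simp add: sum_negf)
qed

end
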